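(* Let $p$ be a prime and $m=p^2+p+1$. Then there exists a subset $A\subseteq\mathbb{Z}_m$ such that $R_A(n)\le 2$ for all $n\in\mathbb{Z}_m$ and $$|\{n\in\mathbb{Z}_m:\ R_A(n)=2\}|=\frac{1}{2}m-\frac{1}{2}.$$
   Context: $\mathbb{Z}_m$ is the additive group of residue classes modulo $m$. For $A\subseteq\mathbb{Z}_m$ and $n\in\mathbb{Z}_m$, $R_A(n)$ denotes the number of ordered pairs $(a,a')\in A\times A$ with $a+a'=n$. *)

theory Defs
  imports Complex_Main "HOL-Algebra.Elementary_Groups" "HOL-Computational_Algebra.Primes"
begin

(* The library group integer_mod_group m is the additive group of residues modulo m with carrier
   {0..<int m}; HOL-Algebra writes its operation, addition modulo m, multiplicatively. *)

definition rep_count :: "nat \<Rightarrow> int set \<Rightarrow> int \<Rightarrow> nat" where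
  "rep_count m A n = card {(a, a'). a \<in> A \<and> a' \<in> A \<and> a \<otimes>\<^bsub>integer_mod_group m\<^esub> a' = n}"

end

theory Submission
  imports Defs "HOL-Number_Theory.Residues" "HOL-Algebra.Polynomial_Divisibility"
begin

(* Singer's construction, in the form given by Bose. Let K be a cubic extension of the field F with q = p
   elements and let \<theta> generate K. Since 1, \<theta>, \<theta>^2 are linearly independent over F, a
   product of two of the q + 1 elements 1 and \<theta> + a (a in F) determines both factors, even up to a
   scalar in F. Taking discrete logarithms in K modulo m = (q^3 - 1) / (q - 1), which kills exactly the
   scalars, turns these elements into a set A of q + 1 residues whose pairwise sums a + b are distinct
   up to order. Hence R_A(n) = 2 exactly when n = a + b with a, b distinct in A, and
   (q + 1 choose 2) = (m - 1) / 2. *)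

hide_const (open) Divisibility.prime Ring_Divisibility.mult_of

section \<open>Sidon sets modulo \<open>m\<close> and their representation counts\<close>

definition sidon_mod :: "nat \<Rightarrow> int set \<Rightarrow> bool" where
  "sidon_mod m A \<longleftrightarrow> (\<forall>a\<in>A. \<forall>b\<in>A. \<forall>c\<in>A. \<forall>d\<in>A.
     (a + b) mod int m = (c + d) mod int m \<longrightarrow> a = c \<and> b = d \<or> a = d \<and> b = c)"

lemma sidon_modD:
  assumes "sidon_mod m A" "a \<in> A" "b \<in> A" "c \<in> A" "d \<in> A"
    "(a + b) mod int m = (c + d) mod int m"
  shows "a = c \<and> b = d \<or> a = d \<and> b = c"
  using assms unfolding sidon_mod_def by blast

text \<open>Only \<open>(a, b)\<close> and \<open>(b, a)\<close> represent this sum. Writing the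
  count as \<open>card {a, b}\<close> covers both doubles, with count 1, and sums of distinct
  elements, with count 2.\<close>

lemma sidon_rep_count:
  assumes "sidon_mod m A" "a \<in> A" "b \<in> A"
  shows "rep_count m A ((a + b) mod int m) = card {a, b}"
proof -
  have "{(x, y). x \<in> A \<and> y \<in> A \<and> x \<otimes>\<^bsub>integer_mod_group m\<^esub> y = (a + b) mod int m} = {(a, b), (b, a)}"
    using assms by (auto simp: add.commute dest: sidon_modD)
  then show ?thesis
    unfolding rep_count_def by (cases "a = b") auto
qed

lemma rep_count_pos:
  assumes "rep_count m A n \<noteq> 0"
  obtains a b where "a \<in> A" "b \<in> A" "n = (a + b) mod int m"
proof -
  have "{(x, y). x \<in> A \<and> y \<in> A \<and> x \<otimes>\<^bsub>integer_mod_group m\<^esub> y = n} \<noteq> {}"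
    using assms unfolding rep_count_def by (rule contrapos_nn) (simp only: card.empty)
  then show thesis using that by auto
qed

lemma sidon_rep_count_le:
  assumes "sidon_mod m A"
  shows "rep_count m A n \<le> 2"
proof (cases "rep_count m A n = 0")
  case False
  then obtain a b where "a \<in> A" "b \<in> A" "n = (a + b) mod int m"
    by (rule rep_count_pos)
  then show ?thesis
    using sidon_rep_count[OF assms] by (simp add: card_insert_if)
qed simp

text \<open>Two-element subsets correspond to their sums modulo \<open>m\<close>: the Sidon property
  makes this injective, and a value counted twice is the sum of two distinct elements.\<close>

lemma sidon_card_rep_count_two:
  assumes A: "sidon_mod m A" "finite A" and "m > 0"
  shows "card {n \<in> carrier (integer_mod_group m). rep_count m A n = 2} = card A choose 2"
proof -
  have pairs: "\<exists>a b. a \<in> A \<and> b \<in> A \<and> a \<noteq> b \<and> B = {a, b}" if "B \<subseteq> A" "card B = 2" for B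
    using that by (auto simp: card_2_iff)
  have "bij_betw (\<lambda>B. \<Sum>B mod int m) {B. B \<subseteq> A \<and> card B = 2}
    {n \<in> carrier (integer_mod_group m). rep_count m A n = 2}"
  proof (rule bij_betw_imageI[OF inj_onI], goal_cases)
    case (1 B C)
    then obtain a b c d where "a \<in> A" "b \<in> A" "a \<noteq> b" "B = {a, b}"
      "c \<in> A" "d \<in> A" "c \<noteq> d" "C = {c, d}"
      using pairs[of B] pairs[of C] by blast
    then show "B = C" using 1(3) sidon_modD[OF A(1), of a b c d] by auto
  next
    case 2
    show ?case
    proof (intro equalityI subsetI)
      fix n assume "n \<in> (\<lambda>B. \<Sum>B mod int m) ` {B. B \<subseteq> A \<and> card B = 2}"
      then obtain B where B: "B \<subseteq> A" "card B = 2" "n = \<Sum>B mod int m" by blast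
      moreover obtain a b where "a \<in> A" "b \<in> A" "a \<noteq> b" "B = {a, b}"
        using pairs[OF B(1,2)] by blast
      ultimately have "a \<in> A" "b \<in> A" "a \<noteq> b" "n = (a + b) mod int m" by simp_all
      then show "n \<in> {n \<in> carrier (integer_mod_group m). rep_count m A n = 2}"
        using sidon_rep_count[OF A(1)] \<open>m > 0\<close> by (simp add: carrier_integer_mod_group)
    next
      fix n assume n: "n \<in> {n \<in> carrier (integer_mod_group m). rep_count m A n = 2}"
      then obtain a b where ab: "a \<in> A" "b \<in> A" "n = (a + b) mod int m"
        using rep_count_pos[of m A n] by (metis (lifting) mem_Collect_eq zero_neq_numeral)
      \<comment> \<open>With \<open>a = b\<close> the count would be
        \<open>card {a} = 1\<close>.\<close>
      then have "a \<noteq> b" using n sidon_rep_count[OF A(1) ab(1,2)] by auto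
      then have "n = \<Sum>{a, b} mod int m" "{a, b} \<in> {B. B \<subseteq> A \<and> card B = 2}"
        using ab by simp_all
      then show "n \<in> (\<lambda>B. \<Sum>B mod int m) ` {B. B \<subseteq> A \<and> card B = 2}"
        by (rule image_eqI)
    qed
  qed
  from bij_betw_same_card[OF this] show ?thesis
    using n_subsets[OF A(2), of 2] by simp
qed

section \<open>Discrete logarithms modulo a subfield\<close>

lemma (in group) nat_pow_eq_imp_mod_eq:
  fixes i j :: nat
  assumes "x \<in> carrier G" "x [^] i = x [^] j"
  shows "i mod ord x = j mod ord x"
proof -
  have "int (ord x) dvd int j - int i"
    using assms int_pow_eq[of x "int i" "int j"] by (simp add: int_pow_int)
  then have "int j mod int (ord x) = int i mod int (ord x)" by (simp add: mod_eq_dvd_iff)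
  then show ?thesis by (metis of_nat_eq_iff zmod_int)
qed

text \<open>By Lagrange the nonzero elements of \<open>F\<close> are roots of
  \<open>X^d - 1\<close>, where \<open>d = card F - 1\<close>, and a field contains at most
  \<open>d\<close> such roots. This later detects scalars among the powers of a generator.\<close>

lemma (in field) subfield_power_eq_one_iff:
  assumes fin: "finite (carrier R)" and F: "subfield F R" and x: "x \<in> carrier R"
  shows "x [^] (card F - 1) = \<one> \<longleftrightarrow> x \<in> F - {\<zero>}"
proof -
  let ?d = "card F - 1"
  let ?S = "{x \<in> carrier R. x [^] ?d = \<one>}"
  interpret K: field "R\<lparr>carrier := F\<rparr>" using subfield_iff(2)[OF F] .
  note sub = subfieldE(3)[OF F]
  have finF: "finite F" using finite_subset[OF sub fin] .
  \<comment> \<open>The bound on the number of roots requires a nonzero exponent, which two distinct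
    elements of \<open>F\<close> guarantee.\<close>
  have "{\<zero>, \<one>} \<subseteq> F" using K.one_closed K.zero_closed by simp
  then have "card {\<zero>, \<one>} \<le> card F" using finF card_mono by blast
  then have d: "?d \<noteq> 0" by simp
  have "F - {\<zero>} \<subseteq> ?S"
  proof
    fix y assume y: "y \<in> F - {\<zero>}"
    interpret G: group "mult_of (R\<lparr>carrier := F\<rparr>)" by (rule K.field_mult_group)
    have "y [^]\<^bsub>mult_of (R\<lparr>carrier := F\<rparr>)\<^esub> order (mult_of (R\<lparr>carrier := F\<rparr>)) = \<one>"
      using G.pow_order_eq_1 y by simp
    moreover have "order (mult_of (R\<lparr>carrier := F\<rparr>)) = ?d"
      using K.order_mult_of finF by (simp add: order_def)
    ultimately have "y [^] ?d = \<one>"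
      by (simp add: nat_pow_mult_of nat_pow_def)
    then show "y \<in> ?S" using y sub by auto
  qed
  moreover have "card ?S \<le> card (F - {\<zero>})"
    using num_roots_le_deg[OF fin d] K.zero_closed finF by simp
  ultimately have "F - {\<zero>} = ?S" by (intro card_seteq) (use fin in auto)
  then show ?thesis using x by blast
qed

text \<open>\<open>L\<close> is a discrete logarithm, reduced modulo the index of the multiplicative group of \<open>F\<close>.\<close>

lemma (in field) exists_log_mod_subfield:
  assumes fin: "finite (carrier R)" and F: "subfield F R"
    and m: "order R - 1 = (card F - 1) * m"
  obtains L :: "'a \<Rightarrow> int"
  where "\<And>x. L x \<in> carrier (integer_mod_group m)"
    and "\<And>x y. \<lbrakk>x \<in> carrier R - {\<zero>}; y \<in> carrier R - {\<zero>}\<rbrakk> \<Longrightarrow> L (x \<otimes> y) = (L x + L y) mod int m"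
    and "\<And>x y. \<lbrakk>x \<in> carrier R - {\<zero>}; y \<in> carrier R - {\<zero>}; L x = L y\<rbrakk> \<Longrightarrow> \<exists>c\<in>F - {\<zero>}. x = c \<otimes> y"
proof -
  interpret G: group "mult_of R" rewrites "([^]\<^bsub>mult_of R\<^esub>) = (([^]) :: _ \<Rightarrow> nat \<Rightarrow> _)" and "\<one>\<^bsub>mult_of R\<^esub> = \<one>"
    by (rule field_mult_group) (simp_all add: fun_eq_iff nat_pow_def)
  obtain g where g: "g \<in> carrier R - {\<zero>}" and gen: "carrier R - {\<zero>} = {g [^] i | i::nat. True}"
    using finite_field_mult_group_has_gen[OF fin] by auto
  have gc: "g \<in> carrier R" using g by simp
  have "order R > 1"
    using card_mono[OF fin, of "{\<zero>, \<one>}"] by (simp add: order_def)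
  then have m0: "m > 0" using m by (cases m) auto
  have ord: "G.ord g = order R - 1"
  proof -
    have "carrier R - {\<zero>} = (\<lambda>i. g [^] i) ` {0..G.ord g - 1}"
      using G.ord_elems[of g] finite_mult_of[OF fin] g gen by auto
    then have "card (carrier R - {\<zero>}) = card {0..G.ord g - 1}"
      using card_image[OF G.ord_inj[of g]] g by simp
    \<comment> \<open>For order 0 the truncated \<open>{0..G.ord g - 1}\<close> would still have one
      element; this bound makes its size equal to the order.\<close>
    moreover have "G.ord g \<ge> 1"
      using G.ord_ge_1[of g] finite_mult_of[OF fin] g by simp
    ultimately show ?thesis using fin by (simp add: order_def)
  qed
  \<comment> \<open>Any exponent will do: exponents of the same element agree modulo
    \<open>order R - 1\<close>, hence modulo \<open>m\<close>.\<close>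
  define e where "e x = (SOME i::nat. g [^] i = x)" for x
  have e: "g [^] e x = x" if "x \<in> carrier R - {\<zero>}" for x
  proof -
    have "x \<in> {g [^] i | i::nat. True}" using that unfolding gen .
    then have "\<exists>i::nat. g [^] i = x" by auto
    then show ?thesis unfolding e_def by (rule someI_ex)
  qed
  define L where "L x = int (e x mod m)" for x
  have pow_eq: "i mod m = j mod m" if "g [^] i = g [^] j" for i j :: nat
  proof -
    have "i mod (order R - 1) = j mod (order R - 1)"
      using G.nat_pow_eq_imp_mod_eq[of g i j] that g by (simp add: ord)
    then show ?thesis unfolding m by (metis dvd_triv_right mod_mod_cancel)
  qed
  \<comment> \<open>The exponents differ by some \<open>k * m\<close>, and
    \<open>g [^] (k * m)\<close> is a scalar because raising it to \<open>card F - 1\<close> gives a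
    power of \<open>g [^] (order R - 1)\<close>.\<close>
  have *: "\<exists>c\<in>F - {\<zero>}. g [^] i = c \<otimes> g [^] j" if "i mod m = j mod m" "j \<le> i" for i j :: nat
  proof -
    have "m dvd i - j" using mod_eq_dvd_iff_nat[OF that(2)] that(1) by blast
    then obtain k where "i - j = m * k" by (rule dvdE)
    then have k: "i = j + k * m" using that(2) by (simp add: mult.commute)
    have "(g [^] (k * m)) [^] (card F - 1) = (g [^] (order R - 1)) [^] k"
      using gc unfolding m by (simp add: nat_pow_pow mult_ac)
    also have "\<dots> = \<one>"
      unfolding ord[symmetric] using g G.pow_ord_eq_1[of g] by simp
    finally have "g [^] (k * m) \<in> F - {\<zero>}"
      using subfield_power_eq_one_iff[OF fin F] gc by simp
    moreover have "g [^] i = g [^] (k * m) \<otimes> g [^] j"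
      unfolding k using gc by (simp add: nat_pow_mult add.commute)
    ultimately show ?thesis by blast
  qed
  show thesis
  proof (rule that[of L])
    show "L x \<in> carrier (integer_mod_group m)" for x
      using m0 by (simp add: L_def carrier_integer_mod_group)
  next
    fix x y assume xy: "x \<in> carrier R - {\<zero>}" "y \<in> carrier R - {\<zero>}"
    then have "x \<otimes> y \<in> carrier R - {\<zero>}" using G.m_closed by simp
    then have "g [^] e (x \<otimes> y) = g [^] (e x + e y)"
      using e xy gc by (simp flip: nat_pow_mult)
    then show "L (x \<otimes> y) = (L x + L y) mod int m"
      unfolding L_def using pow_eq[of "e (x \<otimes> y)" "e x + e y"] by (simp add: zmod_int mod_add_eq)
    assume "L x = L y"
    then have eq: "e x mod m = e y mod m" by (simp add: L_def)
    show "\<exists>c\<in>F - {\<zero>}. x = c \<otimes> y"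
    proof (cases "e y \<le> e x")
      case True
      then show ?thesis using *[OF eq] e xy by simp
    next
      \<comment> \<open>The scalar now leads from \<open>x\<close> to \<open>y\<close>; its inverse
        in \<open>F\<close> leads back.\<close>
      case False
      then obtain c where c: "c \<in> F - {\<zero>}" "y = c \<otimes> x"
        using *[of "e y" "e x"] eq e xy by auto
      have "inv c \<in> F - {\<zero>}" "c \<in> carrier R" "inv c \<otimes> c = \<one>" "inv c \<in> carrier R"
        using subfield_m_inv[OF F c(1)] c(1) subfieldE(3)[OF F] by auto
      then have "x = inv c \<otimes> y" unfolding c(2) using xy by (simp flip: m_assoc)
      then show ?thesis using \<open>inv c \<in> F - {\<zero>}\<close> by blast
    qed
  qed
qed

section \<open>An irreducible cubic over a finite field\<close>

text \<open>In a factorization of a cubic into two nonconstant factors one factor is linear, and a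
  linear polynomial over a field has a root.\<close>

lemma (in field) degree_three_no_root_imp_pirreducible:
  assumes f: "f \<in> carrier (poly_ring R)" "degree f = 3"
    and no_root: "\<And>x. x \<in> carrier R \<Longrightarrow> eval f x \<noteq> \<zero>"
  shows "pirreducible (carrier R) f"
proof (rule pirreducibleI[OF carrier_is_subring f(1)])
  show "f \<noteq> []" using f(2) by (cases f) simp_all
  show "f \<notin> Units (poly_ring R)"
    using univ_poly_units'[OF carrier_is_subfield, of f] f(2) by auto
  have linear: False if "q \<in> carrier (poly_ring R)" "q pdivides f" "degree q = 1" for q
  proof -
    let ?x = "inv (lead_coeff q) \<otimes> const_term q"
    have "eval q (\<ominus> ?x) = \<zero>" "?x \<in> carrier R"
      using degree_one_root[OF carrier_is_subfield that(1,3)] by auto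
    then show False
      using pdivides_imp_root_sharing[OF that(1,2), of "\<ominus> ?x"] no_root[of "\<ominus> ?x"] by simp
  qed
  fix q r assume q: "q \<in> carrier (poly_ring R)" and r: "r \<in> carrier (poly_ring R)"
    and fqr: "f = q \<otimes>\<^bsub>poly_ring R\<^esub> r"
  interpret UP: domain "poly_ring R" by (rule univ_poly_is_domain[OF carrier_is_subring])
  have dvd: "q pdivides f" "r pdivides f"
    using q r fqr UP.m_comm unfolding pdivides_def factor_def by blast+
  have "q \<noteq> []" "r \<noteq> []"
    using fqr \<open>f \<noteq> []\<close> q r UP.l_null UP.r_null unfolding univ_poly_zero by auto
  moreover have "degree f = degree q + degree r"
    using poly_mult_degree_eq[OF carrier_is_subring, of q r] q r calculation
    unfolding fqr univ_poly_mult univ_poly_carrier by simp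
  moreover have "degree q \<noteq> 1" "degree r \<noteq> 1"
    using linear q r dvd by blast+
  ultimately have "degree q = 0 \<or> degree r = 0" using f(2) by linarith
  then show "q \<in> Units (poly_ring R) \<or> r \<in> Units (poly_ring R)"
    using univ_poly_units'[OF carrier_is_subfield] q r \<open>q \<noteq> []\<close> \<open>r \<noteq> []\<close> by blast
qed

text \<open>The map \<open>x \<mapsto> x\<^sup>3 - x\<close> sends both 0 and 1 to 0, so on a finite field it misses some value \<open>c\<close>, and
  \<open>X\<^sup>3 - X - c\<close> has no root.\<close>

lemma (in field) exists_irreducible_cubic:
  assumes fin: "finite (carrier R)"
  obtains f where "f \<in> carrier (poly_ring R)" "degree f = 3" "pirreducible (carrier R) f"
proof -
  define h where "h x = x \<otimes> x \<otimes> x \<ominus> x" for x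
  have closed: "h ` carrier R \<subseteq> carrier R" unfolding h_def by (rule image_subsetI) simp
  have "h \<zero> = \<zero>" "h \<one> = \<zero>"
    unfolding h_def by simp_all
  then have "\<not> inj_on h (carrier R)"
    using inj_onD[of h "carrier R" \<zero> \<one>] zero_closed one_closed zero_not_one by metis
  then have "h ` carrier R \<noteq> carrier R"
    using eq_card_imp_inj_on[OF fin, of h] by metis
  then obtain c where c: "c \<in> carrier R" "c \<notin> h ` carrier R" using closed by blast
  \<comment> \<open>Coefficients are listed from the leading one down: this is
    \<open>X^3 - X - c\<close>.\<close>
  let ?f = "[\<one>, \<zero>, \<ominus> \<one>, \<ominus> c]"
  have f: "?f \<in> carrier (poly_ring R)"
    using c unfolding univ_poly_carrier[symmetric] polynomial_def by auto
  have "eval ?f x \<noteq> \<zero>" if x: "x \<in> carrier R" for x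
  proof
    assume "eval ?f x = \<zero>"
    then have "x \<otimes> x \<otimes> x \<ominus> x \<ominus> c = \<zero>"
      using x c(1) by (simp add: minus_eq l_minus numeral_2_eq_2 numeral_3_eq_3 a_assoc)
    then have "h x = c"
      unfolding h_def using r_right_minus_eq[of "x \<otimes> x \<otimes> x \<ominus> x" c] x c(1) by simp
    then show False using c x by blast
  qed
  then show thesis
    using that[OF f] degree_three_no_root_imp_pirreducible[OF f] by simp
qed

section \<open>Counting by dimension, and identities for quadratics\<close>

text \<open>Coordinates with respect to a basis biject \<open>E\<close> with the lists of length
  \<open>n\<close> over \<open>F\<close>. This gives the cubic extension its \<open>q^3\<close>
  elements.\<close>

lemma (in ring) card_dimension:
  assumes F: "subfield F R" and fin: "finite F" and dim: "dimension n F E"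
  shows "card E = card F ^ n"
proof -
  obtain Us where Us: "set Us \<subseteq> carrier R" "independent F Us" "length Us = n" "Span F Us = E"
    using exists_base[OF F dim] by blast
  let ?S = "{Ks. set Ks \<subseteq> F \<and> length Ks = n}"
  have "bij_betw (\<lambda>Ks. combine Ks Us) ?S E"
    unfolding bij_betw_def
  proof
    show "(\<lambda>Ks. combine Ks Us) ` ?S = E"
      unfolding Us(4)[symmetric] Span_eq_combine_set_length_version[OF F Us(1)] Us(3) by auto
    show "inj_on (\<lambda>Ks. combine Ks Us) ?S"
    proof (rule inj_onI)
      fix Ks Ls assume Ks: "Ks \<in> ?S" and Ls: "Ls \<in> ?S" and eq: "combine Ks Us = combine Ls Us"
      have "combine Ks Us \<in> Span F Us"
        using Span_mem_iff_length_version[OF F Us(1)] Us(3) Ks by blast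
      from unique_decomposition[OF F Us(2) this] Ks Ls eq Us(3) show "Ks = Ls" by auto
    qed
  qed
  then have "card ?S = card E" by (rule bij_betw_same_card)
  then show ?thesis using card_lists_length_eq[OF fin] by simp
qed

text \<open>Both pairs are the roots of one monic quadratic: substituting \<open>a\<close> into
  \<open>(X - d) * (X - e)\<close> gives \<open>a^2 - a * (a + b) + a * b = 0\<close>.\<close>

lemma (in field) quadratic_roots_unique:
  assumes "a \<in> carrier R" "b \<in> carrier R" "d \<in> carrier R" "e \<in> carrier R"
    and sum: "a \<oplus> b = d \<oplus> e" and prod: "a \<otimes> b = d \<otimes> e"
  shows "a = d \<and> b = e \<or> a = e \<and> b = d"
proof -
  have "(a \<ominus> d) \<otimes> (a \<ominus> e) = a \<otimes> a \<ominus> a \<otimes> (d \<oplus> e) \<oplus> d \<otimes> e"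
    using assms(1-4) by algebra
  also have "\<dots> = a \<otimes> a \<ominus> a \<otimes> (a \<oplus> b) \<oplus> a \<otimes> b"
    unfolding sum prod ..
  also have "\<dots> = \<zero>" using assms(1,2) by algebra
  finally have "a = d \<or> a = e" using assms(1-4) by (simp add: integral_iff)
  moreover have "b = e" if "a = d" using sum that assms(1-4) by simp
  moreover have "b = d" if "a = e" using sum that assms(1-4) a_comm[of d e] by simp
  ultimately show ?thesis by blast
qed

text \<open>Isolated with atomic coefficients, which the comparison of two products in
  \<open>lin_mult_eqD\<close> instantiates with compound terms.\<close>

lemma (in cring) quadratic_diff:
  assumes "x \<in> carrier R" "a \<in> carrier R" "b \<in> carrier R" "d \<in> carrier R"
    "a' \<in> carrier R" "b' \<in> carrier R" "d' \<in> carrier R" "c \<in> carrier R"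
  shows "(a \<ominus> c \<otimes> a') \<otimes> (x \<otimes> x) \<oplus> (b \<ominus> c \<otimes> b') \<otimes> x \<oplus> (d \<ominus> c \<otimes> d')
    = (a \<otimes> (x \<otimes> x) \<oplus> b \<otimes> x \<oplus> d) \<ominus> c \<otimes> (a' \<otimes> (x \<otimes> x) \<oplus> b' \<otimes> x \<oplus> d')"
  using assms by algebra

section \<open>Bose's argument in an abstract extension\<close>

text \<open>Separates the argument from the way the extension is built. The assumption
  \<open>indep\<close> is linear independence of 1, \<open>\<theta>\<close> and its square over
  \<open>F\<close>, spelled out in coefficients.\<close>

locale cubic_generator = field R for R (structure) +
  fixes F :: "'a set" and \<theta> :: 'a
  assumes F: "subfield F R"
    and theta: "\<theta> \<in> carrier R"
    and indep: "\<lbrakk>a \<in> F; b \<in> F; c \<in> F; a \<otimes> (\<theta> \<otimes> \<theta>) \<oplus> b \<otimes> \<theta> \<oplus> c = \<zero>\<rbrakk>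
      \<Longrightarrow> a = \<zero> \<and> b = \<zero> \<and> c = \<zero>"
begin

text \<open>The pair \<open>(s, t)\<close> encodes \<open>s \<theta> + t\<close>; \<open>lines\<close> contains one generator of each \<open>F\<close>-line in the
  plane spanned by \<open>\<theta>\<close> and 1.\<close>

definition lin :: "'a \<times> 'a \<Rightarrow> 'a" where
  "lin u = fst u \<otimes> \<theta> \<oplus> snd u"

definition lines :: "('a \<times> 'a) set" where
  "lines = insert (\<zero>, \<one>) (Pair \<one> ` F)"

lemma F_closed [simp]:
  "a \<in> F \<Longrightarrow> a \<in> carrier R" "\<zero> \<in> F" "\<one> \<in> F"
  "\<lbrakk>a \<in> F; b \<in> F\<rbrakk> \<Longrightarrow> a \<oplus> b \<in> F" "\<lbrakk>a \<in> F; b \<in> F\<rbrakk> \<Longrightarrow> a \<otimes> b \<in> F"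
  "\<lbrakk>a \<in> F; b \<in> F\<rbrakk> \<Longrightarrow> a \<ominus> b \<in> F"
  using subfieldE(3)[OF F] subringE[OF subfieldE(1)[OF F]] unfolding minus_eq by auto

lemma linesE:
  assumes "u \<in> lines"
  obtains "u = (\<zero>, \<one>)" | a where "a \<in> F" "u = (\<one>, a)"
  using assms unfolding lines_def by blast

lemma linesD: "u \<in> lines \<Longrightarrow> fst u \<in> F \<and> snd u \<in> F"
  by (erule linesE) auto

lemma card_lines: "finite F \<Longrightarrow> card lines = card F + 1"
  unfolding lines_def by (subst card_insert_disjoint) (auto simp: card_image inj_on_def)

text \<open>Independence with coefficient 0 at the square. The logarithm is controlled only on
  nonzero elements.\<close>

lemma lin_nonzero:
  assumes "u \<in> lines"
  shows "lin u \<in> carrier R - {\<zero>}"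
proof -
  have u: "fst u \<in> F" "snd u \<in> F" using linesD[OF assms] by auto
  have "\<zero> \<otimes> (\<theta> \<otimes> \<theta>) \<oplus> fst u \<otimes> \<theta> \<oplus> snd u = lin u"
    unfolding lin_def using u theta by simp
  moreover have "fst u \<noteq> \<zero> \<or> snd u \<noteq> \<zero>" using assms by (auto elim: linesE)
  ultimately have "lin u \<noteq> \<zero>"
    using indep[of \<zero> "fst u" "snd u"] u by auto
  then show ?thesis unfolding lin_def using u theta by simp
qed

lemma lin_mult:
  assumes "fst u \<in> F" "snd u \<in> F" "fst v \<in> F" "snd v \<in> F"
  shows "lin u \<otimes> lin v = (fst u \<otimes> fst v) \<otimes> (\<theta> \<otimes> \<theta>)
    \<oplus> (fst u \<otimes> snd v \<oplus> snd u \<otimes> fst v) \<otimes> \<theta> \<oplus> snd u \<otimes> snd v"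
  unfolding lin_def using assms[THEN F_closed(1)] theta by algebra

text \<open>Independence permits comparing coefficients: the difference of the two sides is a
  quadratic in \<open>\<theta>\<close> over \<open>F\<close> with value 0.\<close>

lemma lin_mult_eqD:
  assumes u: "fst u \<in> F" "snd u \<in> F" and v: "fst v \<in> F" "snd v \<in> F"
    and w: "fst w \<in> F" "snd w \<in> F" and z: "fst z \<in> F" "snd z \<in> F" and c: "c \<in> F"
    and eq: "lin u \<otimes> lin v = c \<otimes> (lin w \<otimes> lin z)"
  shows "fst u \<otimes> fst v = c \<otimes> (fst w \<otimes> fst z)"
    "fst u \<otimes> snd v \<oplus> snd u \<otimes> fst v = c \<otimes> (fst w \<otimes> snd z \<oplus> snd w \<otimes> fst z)"
    "snd u \<otimes> snd v = c \<otimes> (snd w \<otimes> snd z)"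
proof -
  note closed = u v w z c
  note closed' = closed[THEN F_closed(1)]
  let ?x = "fst u \<otimes> fst v \<ominus> c \<otimes> (fst w \<otimes> fst z)"
  let ?y = "fst u \<otimes> snd v \<oplus> snd u \<otimes> fst v \<ominus> c \<otimes> (fst w \<otimes> snd z \<oplus> snd w \<otimes> fst z)"
  let ?z = "snd u \<otimes> snd v \<ominus> c \<otimes> (snd w \<otimes> snd z)"
  have "?x \<otimes> (\<theta> \<otimes> \<theta>) \<oplus> ?y \<otimes> \<theta> \<oplus> ?z = lin u \<otimes> lin v \<ominus> c \<otimes> (lin w \<otimes> lin z)"
    unfolding lin_mult[OF u v] lin_mult[OF w z]
    by (rule quadratic_diff) (use closed theta in simp_all)
  also have "\<dots> = \<zero>"
    unfolding eq using closed' theta by (simp add: lin_def)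
  finally have "?x = \<zero> \<and> ?y = \<zero> \<and> ?z = \<zero>"
    using closed by (intro indep) simp_all
  then show "fst u \<otimes> fst v = c \<otimes> (fst w \<otimes> fst z)"
    "fst u \<otimes> snd v \<oplus> snd u \<otimes> fst v = c \<otimes> (fst w \<otimes> snd z \<oplus> snd w \<otimes> fst z)"
    "snd u \<otimes> snd v = c \<otimes> (snd w \<otimes> snd z)"
    using closed' by simp_all
qed

text \<open>If all four factors have the form \<open>\<theta> + a\<close>, the leading coefficient
  forces \<open>c = 1\<close>, and the constant terms then agree in sum and product. A factor 1
  lowers the degree in \<open>\<theta>\<close>, so both sides contain equally many of them.\<close>

lemma lines_mult_unique:
  assumes lines: "u \<in> lines" "v \<in> lines" "w \<in> lines" "z \<in> lines" and c: "c \<in> F"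
    and eq: "lin u \<otimes> lin v = c \<otimes> (lin w \<otimes> lin z)"
  shows "u = w \<and> v = z \<or> u = z \<and> v = w"
proof -
  note * = lin_mult_eqD[OF _ _ _ _ _ _ _ _ c eq]
  have c': "c \<in> carrier R" using c by simp
  have eqs: "c \<otimes> (fst w \<otimes> fst z) = fst u \<otimes> fst v"
    "c \<otimes> (fst w \<otimes> snd z \<oplus> snd w \<otimes> fst z) = fst u \<otimes> snd v \<oplus> snd u \<otimes> fst v"
    "c \<otimes> (snd w \<otimes> snd z) = snd u \<otimes> snd v"
    using *[symmetric] linesD lines by blast+
  \<comment> \<open>The generic case, with no factor equal to 1.\<close>
  have quad: ?thesis if "u = (\<one>, a)" "v = (\<one>, b)" "w = (\<one>, d)" "z = (\<one>, e)"
    "a \<in> F" "b \<in> F" "d \<in> F" "e \<in> F" for a b d e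
  proof -
    have "c = \<one>" using eqs(1) that c' by simp
    then have "b \<oplus> a = e \<oplus> d" "a \<otimes> b = d \<otimes> e"
      using eqs(2,3) that by simp_all
    then show ?thesis
      using quadratic_roots_unique[of a b d e] that by (simp add: a_comm)
  qed
  show ?thesis
    using lines(1)
  proof (rule linesE)
    assume u: "u = (\<zero>, \<one>)"
    show ?thesis
      using lines(2,3,4) eqs c'
      by (elim linesE) (simp_all add: u)
  next
    fix a assume u: "a \<in> F" "u = (\<one>, a)"
    show ?thesis
      using lines(2)
    proof (rule linesE)
      assume v: "v = (\<zero>, \<one>)"
      show ?thesis
        using lines(3,4) eqs c' u(1)
        by (elim linesE) (simp_all add: u(2) v)
    next
      fix b assume v: "b \<in> F" "v = (\<one>, b)"
      show ?thesis
        using lines(3,4) eqs c' u(1) v(1) quad[OF u(2) v(2) _ _ u(1) v(1)]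
        by (elim linesE) (simp_all add: u(2) v(2))
    qed
  qed
qed

text \<open>Equal sums of logarithms mean products equal up to a scalar, where
  \<open>lines_mult_unique\<close> applies; the order \<open>q^3\<close> makes \<open>m\<close> the
  index of the multiplicative group of \<open>F\<close>.\<close>

lemma exists_sidon_set:
  assumes fin: "finite (carrier R)" and card: "order R = card F ^ 3"
    and m: "m = (card F)\<^sup>2 + card F + 1"
  obtains A where "A \<subseteq> carrier (integer_mod_group m)" "sidon_mod m A" "card A = card F + 1"
proof -
  have finF: "finite F" using finite_subset[OF subfieldE(3)[OF F] fin] .
  have "card F \<noteq> 0" using finF F_closed(2) by (metis card_eq_0_iff empty_iff)
  \<comment> \<open>With \<open>Suc k\<close> for \<open>q\<close>, the identity
    \<open>q^3 - 1 = (q - 1) * (q^2 + q + 1)\<close> loses its truncated subtractions.\<close>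
  then obtain k where k: "card F = Suc k" by (cases "card F") auto
  have "order R - 1 = (card F - 1) * m"
    unfolding card m k by (simp add: power2_eq_square power3_eq_cube algebra_simps)
  from exists_log_mod_subfield[OF fin F this]
  obtain L :: "'a \<Rightarrow> int" where L: "\<And>x. L x \<in> carrier (integer_mod_group m)"
    and L_mult: "\<And>x y. \<lbrakk>x \<in> carrier R - {\<zero>}; y \<in> carrier R - {\<zero>}\<rbrakk> \<Longrightarrow> L (x \<otimes> y) = (L x + L y) mod int m"
    and L_eq: "\<And>x y. \<lbrakk>x \<in> carrier R - {\<zero>}; y \<in> carrier R - {\<zero>}; L x = L y\<rbrakk> \<Longrightarrow> \<exists>c\<in>F - {\<zero>}. x = c \<otimes> y"
    by metis
  define l where "l u = L (lin u)" for u
  have uniq: "u = w \<and> v = z \<or> u = z \<and> v = w"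
    if "u \<in> lines" "v \<in> lines" "w \<in> lines" "z \<in> lines"
      and eq: "(l u + l v) mod int m = (l w + l z) mod int m" for u v w z
  proof -
    note nz = that(1-4)[THEN lin_nonzero]
    have "lin u \<otimes> lin v \<in> carrier R - {\<zero>}" "lin w \<otimes> lin z \<in> carrier R - {\<zero>}"
      using nz integral_iff by auto
    moreover have "L (lin u \<otimes> lin v) = L (lin w \<otimes> lin z)"
      using eq L_mult nz unfolding l_def by simp
    ultimately obtain c where "c \<in> F - {\<zero>}" "lin u \<otimes> lin v = c \<otimes> (lin w \<otimes> lin z)"
      using L_eq by blast
    then show ?thesis using lines_mult_unique[OF that(1-4)] by blast
  qed
  \<comment> \<open>Contained in \<open>uniq\<close>: equal values have equal doubles.\<close>
  have "inj_on l lines"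
    using uniq by (metis inj_onI)
  show thesis
  proof (rule that[of "l ` lines"])
    show "l ` lines \<subseteq> carrier (integer_mod_group m)" using L unfolding l_def by blast
    show "sidon_mod m (l ` lines)" unfolding sidon_mod_def using uniq by blast
    show "card (l ` lines) = card F + 1"
      using card_image[OF \<open>inj_on l lines\<close>] card_lines[OF finF] by simp
  qed
qed

end

section \<open>The cubic extension as a quotient of the polynomial ring\<close>

text \<open>The class of \<open>X\<close> serves as \<open>\<theta>\<close>. Over the constants, 1,
  \<open>X\<close> and \<open>X^2\<close> span the polynomials of degree below 3. These are their
  own remainders modulo \<open>f\<close>, so the projection is injective on them and preserves
  independence.\<close>

lemma (in field) rupture_cubic_generator:
  assumes f: "f \<in> carrier (poly_ring R)" "degree f = 3" "pirreducible (carrier R) f"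
  shows "cubic_generator (Rupt (carrier R) f)
    (rupture_surj (carrier R) f ` poly_of_const ` carrier R) (rupture_surj (carrier R) f X)"
proof -
  let ?h = "rupture_surj (carrier R) f" and ?C = "poly_of_const ` carrier R"
  note sf = carrier_is_subfield
  note sr = carrier_is_subring
  interpret UP: domain "poly_ring R" by (rule univ_poly_is_domain[OF sr])
  interpret S: field "Rupt (carrier R) f"
    using rupture_is_field_iff_pirreducible[OF sf f(1)] f(3) by blast
  interpret Hom: ring_hom_ring "poly_ring R" "Rupt (carrier R) f" ?h
    using rupture_surj_hom(2)[OF sr f(1)] .
  have one: "\<one>\<^bsub>Rupt (carrier R) f\<^esub> \<noteq> \<zero>\<^bsub>Rupt (carrier R) f\<^esub>" by (rule S.one_not_zero)
  have subf: "subfield (?h ` ?C) (Rupt (carrier R) f)"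
    by (rule Hom.img_is_subfield(2)[OF univ_poly_subfield_of_consts[OF sf] one])
  have X: "X \<in> carrier (poly_ring R)" by (rule var_closed(1)[OF sr])
  have "f \<noteq> []" using f(2) by auto
  have "inj_on ?h (UP.Span ?C (UP.exp_base X 3))"
    unfolding Span_var_pow_base[OF sf]
    using rupture_surj_inj_on[OF sf f(1)]
      pmod_image_characterization[OF sf f(1) \<open>f \<noteq> []\<close>] f(2) by simp
  from Hom.inj_hom_preserves_independent[OF univ_poly_subfield_of_consts[OF sf] one this
      var_pow_base_independent[OF sf]]
  have indep: "S.independent (?h ` ?C) (map ?h (UP.exp_base X 3))" .
  \<comment> \<open>\<open>exp_base\<close> lists the powers in descending order, matching the
    coefficients in \<open>cubic_generator\<close>.\<close>
  have base: "map ?h (UP.exp_base X 3) =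
    [?h X \<otimes>\<^bsub>Rupt (carrier R) f\<^esub> ?h X, ?h X, \<one>\<^bsub>Rupt (carrier R) f\<^esub>]"
    using X by (simp add: UP.exp_base_def numeral_2_eq_2 numeral_3_eq_3)
  show ?thesis
  proof (intro cubic_generator.intro cubic_generator_axioms.intro S.field_axioms)
    show "subfield (?h ` ?C) (Rupt (carrier R) f)" by (rule subf)
    show "?h X \<in> carrier (Rupt (carrier R) f)" using X by simp
    fix a b c
    assume abc: "a \<in> ?h ` ?C" "b \<in> ?h ` ?C" "c \<in> ?h ` ?C"
      and eq: "a \<otimes>\<^bsub>Rupt (carrier R) f\<^esub> (?h X \<otimes>\<^bsub>Rupt (carrier R) f\<^esub> ?h X) \<oplus>\<^bsub>Rupt (carrier R) f\<^esub>
        b \<otimes>\<^bsub>Rupt (carrier R) f\<^esub> ?h X \<oplus>\<^bsub>Rupt (carrier R) f\<^esub> c = \<zero>\<^bsub>Rupt (carrier R) f\<^esub>"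
    have abc': "a \<in> carrier (Rupt (carrier R) f)" "b \<in> carrier (Rupt (carrier R) f)"
        "c \<in> carrier (Rupt (carrier R) f)"
      using abc subfieldE(3)[OF subf] by blast+
    have "S.combine [a, b, c] (map ?h (UP.exp_base X 3)) = \<zero>\<^bsub>Rupt (carrier R) f\<^esub>"
      unfolding base using eq abc' X by (simp add: S.a_assoc)
    then show "a = \<zero>\<^bsub>Rupt (carrier R) f\<^esub> \<and> b = \<zero>\<^bsub>Rupt (carrier R) f\<^esub> \<and> c = \<zero>\<^bsub>Rupt (carrier R) f\<^esub>"
      using S.independent_imp_trivial_combine[OF subf indep, of "[a, b, c]"] abc
      unfolding base by simp
  qed
qed

text \<open>Constants have length at most 1, so they are their own remainders modulo
  \<open>f\<close> and the projection keeps them apart.\<close>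

lemma (in field) card_rupture_consts:
  assumes f: "f \<in> carrier (poly_ring R)" "degree f > 0"
  shows "card (rupture_surj (carrier R) f ` poly_of_const ` carrier R) = order R"
proof -
  note sf = carrier_is_subfield
  have "f \<noteq> []" using f(2) by auto
  have "inj_on poly_of_const (carrier R)"
    unfolding poly_of_const_def by (rule inj_onI) (simp split: if_splits)
  moreover have "poly_of_const ` carrier R \<subseteq> {q \<in> carrier (poly_ring R). length q \<le> degree f}"
    using f(2) unfolding poly_of_const_def univ_poly_carrier[symmetric] polynomial_def by auto
  then have "inj_on (rupture_surj (carrier R) f) (poly_of_const ` carrier R)"
    using rupture_surj_inj_on[OF sf f(1)] inj_on_subset
    unfolding pmod_image_characterization[OF sf f(1) \<open>f \<noteq> []\<close>] by blast
  ultimately show ?thesis by (simp add: card_image order_def)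
qed

text \<open>The copy of the base field inside the quotient has \<open>order R\<close> elements, so
  \<open>m\<close> is the modulus that \<open>exists_sidon_set\<close> expects.\<close>

theorem (in field) singer_sidon_set:
  assumes fin: "finite (carrier R)" and m: "m = (order R)\<^sup>2 + order R + 1"
  obtains A where "A \<subseteq> carrier (integer_mod_group m)" "sidon_mod m A" "card A = order R + 1"
proof -
  obtain f where f: "f \<in> carrier (poly_ring R)" "degree f = 3" "pirreducible (carrier R) f"
    using exists_irreducible_cubic[OF fin] .
  let ?F = "rupture_surj (carrier R) f ` poly_of_const ` carrier R"
  interpret S: cubic_generator "Rupt (carrier R) f" ?F "rupture_surj (carrier R) f X"
    by (rule rupture_cubic_generator[OF f])
  have cardF: "card ?F = order R" using card_rupture_consts f by simp
  have "S.dimension 3 ?F (carrier (Rupt (carrier R) f))"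
    using rupture_dimension[OF carrier_is_subfield f(1)] f(2) by simp
  then have "order (Rupt (carrier R) f) = card ?F ^ 3"
    unfolding order_def using S.card_dimension[OF S.F] fin by simp
  moreover have "order R > 0" using fin order_gt_0_iff_finite by simp
  \<comment> \<open>An infinite carrier would have \<open>order\<close> 0, but this order is a
    positive cube.\<close>
  ultimately have "finite (carrier (Rupt (carrier R) f))"
    unfolding order_def cardF by (simp add: card_ge_0_finite)
  from S.exists_sidon_set[OF this \<open>order (Rupt (carrier R) f) = card ?F ^ 3\<close>, of m]
  show thesis using that m cardF by auto
qed

theorem theorem1p2:
  fixes p m :: nat
  assumes "prime p" and "m = p^2 + p + 1"
  shows "\<exists>A. A \<subseteq> carrier (integer_mod_group m)
    \<and> (\<forall>n \<in> carrier (integer_mod_group m). rep_count m A n \<le> 2)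
    \<and> real (card {n \<in> carrier (integer_mod_group m). rep_count m A n = 2}) = 1/2 * real m - 1/2"
proof -
  \<comment> \<open>This supplies the field with \<open>p\<close> elements.\<close>
  interpret residues_prime p "residue_ring (int p)"
    by (simp_all add: residues_prime_def assms(1))
  have "order (residue_ring (int p)) = p"
    by (simp add: order_def res_carrier_eq)
  then obtain A where A: "A \<subseteq> carrier (integer_mod_group m)" "sidon_mod m A" "card A = p + 1"
    using singer_sidon_set[of m] assms(2) by auto
  then have "finite A" by (intro card_ge_0_finite) simp
  then have "card {n \<in> carrier (integer_mod_group m). rep_count m A n = 2} = (p + 1) choose 2"
    using sidon_card_rep_count_two[OF A(2)] A(3) assms(2) by simp
  \<comment> \<open>Both sides equal \<open>p * (p + 1) / 2\<close>.\<close>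
  moreover have "real ((p + 1) choose 2) = 1/2 * real m - 1/2"
    unfolding assms(2) by (simp add: choose_two real_of_nat_div power2_eq_square field_simps)
  ultimately show ?thesis using A(1) sidon_rep_count_le[OF A(2)] by auto
qed

end
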